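(* Suppose that $q\in(1,\infty)\setminus\mathcal V$. Then $$\mathcal U_q=\overline{\mathcal U_q}=\mathcal V_q,$$ where $\overline{\mathcal U_q}$ denotes the topological closure of $\mathcal U_q$.
   Context: Let $\mathbb N=\{1,2,\dots\}$. A sequence is an element of $\{0,1,2,\dots\}^{\mathbb N}$; it is called infinite if it has infinitely many nonzero terms, and finite otherwise. Sequences are compared lexicographically. For a real $q>1$, let $\lceil q\rceil$ be the smallest integer $\ge q$ and let $J_q=[0,(\lceil q\rceil-1)/(q-1)]$. An expansion of a real number $x$ in base $q$ is a sequence $(c_i)$ of integers with $0\le c_i<q$ for all $i\ge1$ and $x=\sum_{i\ge1}c_iq^{-i}$. The quasi-greedy expansion $(a_i(x))$ of $x\in J_q\setminus\{0\}$ in base $q$ is its lexicographically largest infinite expansion (it exists); the quasi-greedy expansion of $0$ is $0^\infty$. Write $(\alpha_i)=(\alpha_i(q))$ for the quasi-greedy expansion of $1$ in base $q$; one has $\alpha_1=\lceil q\rceil-1$. For a digit $c\in\{0,\dots,\alpha_1\}$ put $\overline c=\alpha_1-c$, and $\overline{c_1c_2\ldots}=\overline{c_1}\,\overline{c_2}\ldots$. $\mathcal V$ is the set of real numbers $q>1$ for which $\overline{\alpha_{k+1}(q)\alpha_{k+2}(q)\ldots}\le\alpha_1(q)\alpha_2(q)\ldots$ for all $k\ge1$. For $q>1$, $\mathcal U_q$ is the set of real numbers $x$ having exactly one expansion in base $q$, and $$\mathcal V_q=\{x\in J_q:\ \overline{a_{n+1}(x)a_{n+2}(x)\ldots}\le\alpha_1\alpha_2\ldots\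 \text{whenever } a_n(x)>0\}.$$ *)

theory Defs
  imports "HOL-Analysis.Analysis" "HOL-Library.Fun_Lexorder"
begin

text \<open>A sequence \<open>c\<^sub>1 c\<^sub>2 c\<^sub>3 \<dots>\<close> of nonnegative integers is a function \<open>c :: nat \<Rightarrow> nat\<close>
  shifted by one: the term \<open>c\<^sub>i\<close> is \<open>c (i - 1)\<close> for \<open>i \<ge> 1\<close>. In particular the tail
  \<open>c\<^sub>n\<^sub>+\<^sub>1 c\<^sub>n\<^sub>+\<^sub>2 \<dots>\<close> is \<open>tail_seq n c\<close>.\<close>

definition tail_seq :: "nat \<Rightarrow> (nat \<Rightarrow> nat) \<Rightarrow> nat \<Rightarrow> nat"
  where "tail_seq n c = (\<lambda>i. c (n + i))"

definition infinite_seq :: "(nat \<Rightarrow> nat) \<Rightarrow> bool"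
  where "infinite_seq c \<longleftrightarrow> infinite {i. c i \<noteq> 0}"

definition lex_le :: "(nat \<Rightarrow> nat) \<Rightarrow> (nat \<Rightarrow> nat) \<Rightarrow> bool"
  where "lex_le c d \<longleftrightarrow> less_fun c d \<or> c = d"

definition is_expansion :: "real \<Rightarrow> real \<Rightarrow> (nat \<Rightarrow> nat) \<Rightarrow> bool"
  where "is_expansion q x c \<longleftrightarrow>
    (\<forall>i. real (c i) < q) \<and> (\<lambda>i. real (c i) / q ^ (i + 1)) sums x"

definition J :: "real \<Rightarrow> real set"
  where "J q = {0 .. (of_int \<lceil>q\<rceil> - 1) / (q - 1)}"

text \<open>The description is meaningful for \<open>q > 1\<close> and \<open>x \<in> J q\<close>.\<close>

definition quasi_greedy :: "real \<Rightarrow> real \<Rightarrow> nat \<Rightarrow> nat"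
  where "quasi_greedy q x =
    (if x = 0 then (\<lambda>_. 0)
     else (THE a. is_expansion q x a \<and> infinite_seq a \<and>
             (\<forall>c. is_expansion q x c \<and> infinite_seq c \<longrightarrow> lex_le c a)))"

definition \<alpha> :: "real \<Rightarrow> nat \<Rightarrow> nat"
  where "\<alpha> q = quasi_greedy q 1"

text \<open>The subtraction on \<open>nat\<close> does not truncate where \<open>reflect\<close> is used: for \<open>q > 1\<close>, digits of
  an expansion in base \<open>q\<close> are at most \<open>\<lceil>q\<rceil> - 1\<close>, which is \<open>\<alpha> q 0\<close> (the first digit \<open>\<alpha>\<^sub>1\<close>).\<close>

definition reflect :: "real \<Rightarrow> (nat \<Rightarrow> nat) \<Rightarrow> nat \<Rightarrow> nat"
  where "reflect q c = (\<lambda>i. \<alpha> q 0 - c i)"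

definition V_bases :: "real set"
  where "V_bases = {q. q > 1 \<and> (\<forall>k\<ge>1. lex_le (reflect q (tail_seq k (\<alpha> q))) (\<alpha> q))}"

definition U_set :: "real \<Rightarrow> real set"
  where "U_set q = {x. \<exists>!c. is_expansion q x c}"

text \<open>The digit \<open>a\<^sub>n(x)\<close> is \<open>quasi_greedy q x (n - 1)\<close>.\<close>

definition V_set :: "real \<Rightarrow> real set"
  where "V_set q = {x \<in> J q. \<forall>n\<ge>1. quasi_greedy q x (n - 1) > 0 \<longrightarrow>
    lex_le (reflect q (tail_seq n (quasi_greedy q x))) (\<alpha> q)}"

end

theory Submission
  imports Defs
begin

text \<open>
  Write \<open>m\<close> for the largest digit, \<open>M\<close> for the value of the constant sequence \<open>m\<close>, and
  \<open>t\<^sub>n\<close> for the value of the tail of a digit sequence \<open>c\<close> after its digit number \<open>n\<close>.  Another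
  expansion of the same number that agrees with \<open>c\<close> before \<open>c\<^sub>n\<close> can have a larger digit there
  only if \<open>t\<^sub>n \<ge> 1\<close>, and a smaller one only if \<open>M - t\<^sub>n \<ge> 1\<close>.  Hence \<open>c\<close> is a unique expansion iff
  \<open>t\<^sub>n < 1\<close> whenever \<open>c\<^sub>n < m\<close> and \<open>M - t\<^sub>n < 1\<close> whenever \<open>c\<^sub>n > 0\<close>.  Let \<open>K\<close> (below:
  \<open>admissible\<close>) be the set of digit sequences that satisfy the non-strict versions of these
  inequalities.  It is compact in the product topology and the value map is continuous, so the
  set of values of \<open>K\<close> is closed.  It therefore suffices that this set is both \<open>U_set q\<close> and
  \<open>V_set q\<close> when \<open>q\<close> is not in \<open>V_bases\<close>.

  The key point is that for such \<open>q\<close> equality never occurs in the inequalities defining \<open>K\<close>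
  (\<open>admissible_tail_less_one\<close>).  By reflection it is enough to exclude a tail of value \<open>1\<close>.  This
  tail lies in \<open>K\<close> again.  Moreover \<open>M > 1\<close>, and then every nonzero sequence of \<open>K\<close> is infinite
  and so is a quasi-greedy expansion.  Thus \<open>\<alpha>\<close> itself lies in \<open>K\<close>, which forces the reflected
  tails of \<open>\<alpha>\<close> to have values at most \<open>1\<close>, first after positive digits and then, by induction,
  after all digits.  Being zero or quasi-greedy, they are lexicographically at most \<open>\<alpha>\<close>, so
  \<open>q\<close> is in \<open>V_bases\<close>.

  The lexicographic condition in \<open>V_set\<close> is turned into inequalities between values by
  \<open>tail_le_one_if_lex_le\<close>, and the converse is \<open>lex_le_\<alpha>\<close>.
\<close>

section \<open>Lexicographic order and tails\<close>

lemma first_difference: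
  fixes f g :: "nat \<Rightarrow> nat"
  assumes "f \<noteq> g"
  obtains i where "f i \<noteq> g i" "\<And>j. j < i \<Longrightarrow> f j = g j"
proof -
  have ex: "\<exists>i. f i \<noteq> g i" using assms by auto
  show ?thesis
    by (rule that[of "LEAST i. f i \<noteq> g i"]) (use LeastI_ex[OF ex] not_less_Least in auto)
qed

lemma lex_le_total: "lex_le c d \<or> less_fun d c"
proof (cases "c = d")
  case False
  then obtain i where "c i \<noteq> d i" "\<And>j. j < i \<Longrightarrow> c j = d j" by (rule first_difference) auto
  then show ?thesis unfolding lex_le_def less_fun_def by (metis linorder_neqE_nat)
qed (simp add: lex_le_def)

lemma lex_le_antisym: "lex_le c d \<Longrightarrow> lex_le d c \<Longrightarrow> c = d"
  unfolding lex_le_def using less_fun_asym by blast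

lemma tail_seq_apply: "tail_seq n c i = c (n + i)"
  by (simp add: tail_seq_def)

lemma tail_seq_tail_seq [simp]: "tail_seq k (tail_seq n c) = tail_seq (n + k) c"
  by (auto simp: tail_seq_def add.assoc)

lemma tail_seq_0 [simp]: "tail_seq 0 c = c"
  by (simp add: tail_seq_def)

lemma infinite_seq_tail: "infinite_seq (tail_seq n c) \<longleftrightarrow> infinite_seq c"
proof -
  have "(\<exists>i\<ge>b. tail_seq n c i \<noteq> 0) \<longleftrightarrow> (\<exists>i\<ge>n+b. c i \<noteq> 0)" for b
  proof
    assume "\<exists>i\<ge>n+b. c i \<noteq> 0"
    then obtain i where "i \<ge> n + b" "c i \<noteq> 0" by auto
    then show "\<exists>i\<ge>b. tail_seq n c i \<noteq> 0"
      by (intro exI[of _ "i - n"]) (auto simp: tail_seq_apply)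
  qed (use add_left_mono in \<open>fastforce simp: tail_seq_apply\<close>)
  then show ?thesis
    unfolding infinite_seq_def infinite_nat_iff_unbounded_le mem_Collect_eq
    by (metis le_add2 order_trans)
qed

lemma infinite_seqD: "infinite_seq c \<Longrightarrow> \<exists>i. c i \<noteq> 0"
  unfolding infinite_seq_def by (metis (mono_tags) empty_Collect_eq finite.emptyI)

section \<open>Values of digit sequences\<close>

locale base =
  fixes q :: real
  assumes q_gt_1: "1 < q"
begin

text \<open>The largest digit.\<close>
definition m :: nat where "m = nat (\<lceil>q\<rceil> - 1)"

text \<open>The sequences that are expansions in base \<open>q\<close> of their values (\<open>is_expansion_iff\<close>).\<close>
definition digits :: "(nat \<Rightarrow> nat) set" where "digits = {c. \<forall>i. c i \<le> m}"

text \<open>The number represented by a digit sequence in base \<open>q\<close>.\<close>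
definition val :: "(nat \<Rightarrow> nat) \<Rightarrow> real" where "val c = (\<Sum>i. real (c i) / q ^ (i + 1))"

text \<open>The largest number that has an expansion.\<close>
definition M :: real where "M = real m / (q - 1)"

text \<open>The reflection of digit sequences, with the largest digit \<open>m\<close> in place of \<open>\<alpha> q 0\<close>.\<close>
definition flip :: "(nat \<Rightarrow> nat) \<Rightarrow> nat \<Rightarrow> nat" where "flip c = (\<lambda>i. m - c i)"

lemma m_bounds: "real m < q" "q \<le> real m + 1" "1 \<le> m"
proof -
  have c: "\<lceil>q\<rceil> \<ge> 2" using q_gt_1 by linarith
  then have "real m = of_int \<lceil>q\<rceil> - 1" by (simp add: m_def)
  then show "real m < q" "q \<le> real m + 1" by linarith+
  show "1 \<le> m" using c unfolding m_def by linarith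
qed

lemma digit_iff: "real k < q \<longleftrightarrow> k \<le> m"
proof
  assume "real k < q"
  with m_bounds(2) have "real k < real m + 1" by linarith
  then show "k \<le> m" by linarith
next
  assume "k \<le> m"
  then have "real k \<le> real m" by simp
  with m_bounds(1) show "real k < q" by linarith
qed

lemma M_ge_1: "1 \<le> M"
  using m_bounds q_gt_1 by (simp add: M_def)

lemma M_eq: "(M + real m) / q = M"
  using q_gt_1 by (simp add: M_def field_simps)

lemma J_eq: "J q = {0..M}"
proof -
  have "\<lceil>q\<rceil> \<ge> 2" using q_gt_1 by linarith
  then show ?thesis by (simp add: J_def M_def m_def)
qed

lemma digits_le: "c \<in> digits \<Longrightarrow> c i \<le> m"
  by (simp add: digits_def)

lemma tail_digits [simp]: "c \<in> digits \<Longrightarrow> tail_seq n c \<in> digits"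
  by (simp add: digits_def tail_seq_apply)

lemma flip_digits [simp]: "flip c \<in> digits"
  by (simp add: digits_def flip_def)

lemma flip_less_m: "flip c n < m \<Longrightarrow> 0 < c n"
  by (auto simp: flip_def intro: gr0I)

lemma flip_pos: "0 < flip c n \<Longrightarrow> c n < m"
  by (simp add: flip_def)

lemma tail_flip: "tail_seq n (flip c) = flip (tail_seq n c)"
  by (simp add: tail_seq_def flip_def)

lemma constant_m_sums: "(\<lambda>i. real m / q ^ (i + 1)) sums M"
proof -
  have "(\<lambda>i. real m / q * (1 / q) ^ i) sums (real m / q * (1 / (1 - 1 / q)))"
    by (intro sums_mult geometric_sums) (use q_gt_1 in auto)
  also have "real m / q * (1 / (1 - 1 / q)) = M"
    using q_gt_1 by (simp add: M_def field_simps)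
  finally show ?thesis by (simp add: power_one_over)
qed

lemma term_bound:
  assumes "c \<in> digits"
  shows "norm (real (c i) / q ^ (i + 1)) \<le> real m / q ^ (i + 1)"
  using digits_le[OF assms, of i] q_gt_1 by (simp add: divide_right_mono)

lemma summable_val: "c \<in> digits \<Longrightarrow> summable (\<lambda>i. real (c i) / q ^ (i + 1))"
  by (rule summable_comparison_test'[OF sums_summable[OF constant_m_sums] term_bound])

lemma sums_val: "c \<in> digits \<Longrightarrow> (\<lambda>i. real (c i) / q ^ (i + 1)) sums val c"
  unfolding val_def by (rule summable_sums[OF summable_val])

lemma is_expansion_iff: "is_expansion q x c \<longleftrightarrow> c \<in> digits \<and> val c = x"
  unfolding is_expansion_def digit_iff
  using sums_val sums_unique2 by (auto simp: digits_def)

lemma val_nonneg: "c \<in> digits \<Longrightarrow> 0 \<le> val c"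
  unfolding val_def by (rule suminf_nonneg[OF summable_val]) (use q_gt_1 in auto)

lemma val_flip:
  assumes "c \<in> digits"
  shows "val (flip c) = M - val c"
proof -
  have "(\<lambda>i. real m / q ^ (i + 1) - real (c i) / q ^ (i + 1)) sums (M - val c)"
    by (rule sums_diff[OF constant_m_sums sums_val[OF assms]])
  moreover have "real m / q ^ (i + 1) - real (c i) / q ^ (i + 1) = real (flip c i) / q ^ (i + 1)"
    for i
    using digits_le[OF assms, of i] by (simp add: flip_def of_nat_diff diff_divide_distrib)
  ultimately show ?thesis using sums_val[OF flip_digits, of c] sums_unique2 by auto
qed

lemma val_le_M: "c \<in> digits \<Longrightarrow> val c \<le> M"
  using val_nonneg[OF flip_digits, of c] val_flip[of c] by simp

lemma val_split:
  assumes "c \<in> digits"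
  shows "val c = (\<Sum>i<n. real (c i) / q ^ (i + 1)) + val (tail_seq n c) / q ^ n"
proof -
  have "val c = (\<Sum>i. real (c (i + n)) / q ^ (i + n + 1)) + (\<Sum>i<n. real (c i) / q ^ (i + 1))"
    unfolding val_def using suminf_split_initial_segment[OF summable_val[OF assms]] by simp
  also have "(\<Sum>i. real (c (i + n)) / q ^ (i + n + 1))
      = (\<Sum>i. real (tail_seq n c i) / q ^ (i + 1) / q ^ n)"
    using q_gt_1 by (intro suminf_cong) (simp add: tail_seq_apply add.commute power_add field_simps)
  also have "\<dots> = val (tail_seq n c) / q ^ n"
    unfolding val_def by (rule suminf_divide[OF summable_val[OF tail_digits[OF assms]]])
  finally show ?thesis by simp
qed

lemma val_first:
  assumes "c \<in> digits"
  shows "val c = (real (c 0) + val (tail_seq 1 c)) / q"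
  using val_split[OF assms, of 1] by (simp add: add_divide_distrib)

text \<open>The order of two values is decided by the first difference of the sequences and the tails
  after it.\<close>
lemma val_diff:
  assumes "f \<in> digits" "g \<in> digits" "\<And>j. j < i \<Longrightarrow> f j = g j"
  shows "val f - val g = (real (f i) - real (g i)
    + val (tail_seq (Suc i) f) - val (tail_seq (Suc i) g)) / q ^ Suc i"
proof -
  have "(\<Sum>j<i. real (f j) / q ^ (j + 1)) = (\<Sum>j<i. real (g j) / q ^ (j + 1))"
    using assms(3) by simp
  then show ?thesis
    using val_split[OF assms(1), of "Suc i"] val_split[OF assms(2), of "Suc i"]
    by (simp add: add_divide_distrib diff_divide_distrib)
qed

lemma val_pos:
  assumes "c \<in> digits" "infinite_seq c"
  shows "0 < val c"
proof -
  have "(\<lambda>_. 0) \<noteq> c" using infinite_seqD[OF assms(2)] by auto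
  then obtain i where i: "0 \<noteq> c i" "\<And>j. j < i \<Longrightarrow> 0 = c j" by (rule first_difference) auto
  have "val c = (\<Sum>j<i. real (c j) / q ^ (j + 1)) + (real (c i) / q ^ (i + 1))
      + val (tail_seq (Suc i) c) / q ^ Suc i"
    using val_split[OF assms(1), of "Suc i"] by simp
  also have "(\<Sum>j<i. real (c j) / q ^ (j + 1)) = 0" using i(2) by (intro sum.neutral) auto
  finally show ?thesis
    using i(1) q_gt_1 val_nonneg[OF tail_digits[OF assms(1)], of "Suc i"]
    by (simp add: add_pos_nonneg)
qed

lemma val_0 [simp]: "val (\<lambda>_. 0) = 0"
  by (simp add: val_def)

lemma val_m [simp]: "val (\<lambda>_. m) = M"
  unfolding val_def by (rule sums_unique[OF constant_m_sums, symmetric])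

section \<open>Quasi-greedy expansions\<close>

text \<open>Quasi-greedy sequences described through the values of their tails:
  \<open>quasi_greedy_eq\<close> and \<open>qg_seq_quasi_greedy\<close> show the agreement with the lexicographic
  definition.\<close>
definition qg_seq :: "(nat \<Rightarrow> nat) \<Rightarrow> bool" where
  "qg_seq c \<longleftrightarrow> c \<in> digits \<and> infinite_seq c \<and>
    (\<forall>n. c n < m \<longrightarrow> val (tail_seq (Suc n) c) \<le> 1)"

text \<open>If \<open>d\<close> is larger than a quasi-greedy \<open>c\<close>, then at the first difference the digit gained
  outweighs the tail of \<open>c\<close>, which is at most \<open>1\<close>.\<close>
lemma qg_seq_val_less:
  assumes c: "qg_seq c" and d: "d \<in> digits" "infinite_seq d" and less: "less_fun c d"
  shows "val c < val d"
proof -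
  obtain i where i: "c i < d i" "\<And>j. j < i \<Longrightarrow> c j = d j"
    using less by (rule less_funE) auto
  have cD: "c \<in> digits" using c by (simp add: qg_seq_def)
  have "c i < m" using i(1) digits_le[OF d(1), of i] by simp
  then have "val (tail_seq (Suc i) c) \<le> 1" using c by (simp add: qg_seq_def)
  moreover have "0 < val (tail_seq (Suc i) d)"
    using d by (intro val_pos) (auto simp: infinite_seq_tail)
  moreover have "real (c i) + 1 \<le> real (d i)" using i(1) by simp
  ultimately have "real (c i) - real (d i) + val (tail_seq (Suc i) c) - val (tail_seq (Suc i) d) < 0"
    by linarith
  then have "val c - val d < 0"
    by (subst val_diff[of c d i, OF cD d(1) i(2)]) (use q_gt_1 in \<open>auto intro!: divide_neg_pos\<close>)
  then show ?thesis by simp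
qed

lemma quasi_greedy_eq:
  assumes "qg_seq c"
  shows "quasi_greedy q (val c) = c"
proof -
  have c: "c \<in> digits" "infinite_seq c" using assms by (auto simp: qg_seq_def)
  have max: "lex_le d c" if "is_expansion q (val c) d \<and> infinite_seq d" for d
    using that qg_seq_val_less[OF assms, of d] lex_le_total[of d c]
    by (auto simp: is_expansion_iff)
  have "val c \<noteq> 0" using val_pos[OF c] by simp
  moreover have "(THE a. is_expansion q (val c) a \<and> infinite_seq a \<and>
      (\<forall>d. is_expansion q (val c) d \<and> infinite_seq d \<longrightarrow> lex_le d a)) = c"
  proof (rule the_equality)
    show "is_expansion q (val c) c \<and> infinite_seq c \<and>
        (\<forall>d. is_expansion q (val c) d \<and> infinite_seq d \<longrightarrow> lex_le d c)"
      using max c by (auto simp: is_expansion_iff)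
  next
    fix a assume "is_expansion q (val c) a \<and> infinite_seq a \<and>
        (\<forall>d. is_expansion q (val c) d \<and> infinite_seq d \<longrightarrow> lex_le d a)"
    then show "a = c" using max[of a] c lex_le_antisym by (auto simp: is_expansion_iff)
  qed
  ultimately show ?thesis by (simp add: quasi_greedy_def)
qed

text \<open>The quasi-greedy algorithm keeps a remainder \<open>r\<close>, of which it splits off the largest digit
  \<open>k \<le> m\<close> with \<open>k < q * r\<close>.\<close>
lemma greedy_step:
  assumes "0 < r" "r \<le> M"
  obtains k where "k \<le> m" "0 < q * r - real k" "q * r - real k \<le> M"
    "k < m \<longrightarrow> q * r - real k \<le> 1"
proof (cases "q * r \<le> real m")
  case True
  define k where "k = nat (\<lceil>q * r\<rceil> - 1)"
  have "0 < q * r" using assms q_gt_1 by simp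
  then have "real k = of_int \<lceil>q * r\<rceil> - 1" by (simp add: k_def)
  then have k: "0 < q * r - real k" "q * r - real k \<le> 1" by linarith+
  moreover from this True have "real k \<le> real m" by linarith
  ultimately show thesis using M_ge_1 by (intro that[of k]) auto
next
  case False
  have "q * r \<le> q * M" using assms q_gt_1 by simp
  also have "\<dots> = M + real m" using M_eq q_gt_1 by (simp add: field_simps)
  finally show thesis using False by (intro that[of m]) auto
qed

lemma qg_seq_ex:
  assumes "0 < x" "x \<le> M"
  obtains c where "qg_seq c" "val c = x"
proof -
  have "\<forall>r. \<exists>k. 0 < r \<and> r \<le> M \<longrightarrow> k \<le> m \<and> 0 < q * r - real k \<and> q * r - real k \<le> M
      \<and> (k < m \<longrightarrow> q * r - real k \<le> 1)"
    by (metis greedy_step)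
  then obtain dig where dig: "\<And>r. 0 < r \<Longrightarrow> r \<le> M \<Longrightarrow> dig r \<le> m \<and> 0 < q * r - real (dig r)
      \<and> q * r - real (dig r) \<le> M \<and> (dig r < m \<longrightarrow> q * r - real (dig r) \<le> 1)"
    by metis
  define R where "R = rec_nat x (\<lambda>_ r. q * r - real (dig r))"
  have R0: "R 0 = x" and RS: "\<And>n. R (Suc n) = q * R n - real (dig (R n))"
    by (simp_all add: R_def)
  have R: "0 < R n \<and> R n \<le> M" for n
    by (induction n) (use assms dig in \<open>auto simp: R0 RS\<close>)
  define c where "c = (\<lambda>n. dig (R n))"
  have cD: "c \<in> digits" using dig R by (auto simp: digits_def c_def)
  have R_shift: "R (n + Suc i) = q * R (n + i) - real (c (n + i))" for n i
    by (simp add: RS c_def)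
  have partial: "(\<Sum>i<k. real (tail_seq n c i) / q ^ (i + 1)) = R n - R (n + k) / q ^ k" for n k
  proof (induction k)
    case (Suc k)
    have "R (n + Suc k) / q ^ Suc k = R (n + k) / q ^ k - real (tail_seq n c k) / q ^ (k + 1)"
      unfolding R_shift using q_gt_1 by (simp add: tail_seq_apply field_simps)
    then show ?case using Suc.IH by simp
  qed simp
  have val_tail: "val (tail_seq n c) = R n" for n
  proof -
    have inv: "(\<lambda>k. M / q ^ k) \<longlonglongrightarrow> 0"
      using q_gt_1 LIMSEQ_divide_realpow_zero by blast
    have "(\<lambda>k. R (n + k) / q ^ k) \<longlonglongrightarrow> 0"
      by (rule tendsto_sandwich[OF _ _ tendsto_const inv])
        (use R q_gt_1 in \<open>auto simp: less_imp_le divide_right_mono\<close>)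
    then have "(\<lambda>k. R n - R (n + k) / q ^ k) \<longlonglongrightarrow> R n - 0" by (intro tendsto_intros)
    then have "(\<lambda>i. real (tail_seq n c i) / q ^ (i + 1)) sums R n"
      unfolding sums_def partial by simp
    then show ?thesis using sums_val[OF tail_digits[OF cD], of n] sums_unique2 by blast
  qed
  have "infinite_seq c"
    unfolding infinite_seq_def
  proof
    assume "finite {i. c i \<noteq> 0}"
    then obtain n where "\<forall>i\<in>{i. c i \<noteq> 0}. i < n" using finite_nat_set_iff_bounded by blast
    then have "tail_seq n c = (\<lambda>_. 0)" unfolding tail_seq_def by (metis mem_Collect_eq not_add_less1)
    then show False using val_tail[of n] R[of n] by simp
  qed
  moreover have "val (tail_seq (Suc n) c) \<le> 1" if "c n < m" for n
    using dig[of "R n"] R[of n] that unfolding val_tail RS by (simp add: c_def)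
  ultimately have "qg_seq c" using cD by (simp add: qg_seq_def)
  then show thesis using val_tail[of 0] R0 by (intro that) auto
qed

lemma qg_seq_quasi_greedy:
  assumes "0 < x" "x \<le> M"
  shows "qg_seq (quasi_greedy q x)" "val (quasi_greedy q x) = x"
  using qg_seq_ex[OF assms] quasi_greedy_eq by metis+

lemma expansion_ex:
  assumes "0 \<le> x" "x \<le> M"
  obtains c where "c \<in> digits" "val c = x"
proof (cases "x = 0")
  case True
  then show thesis using that[of "\<lambda>_. 0"] by (simp add: digits_def)
next
  case False
  then show thesis using qg_seq_ex[of x] assms that by (metis less_eq_real_def qg_seq_def)
qed

lemma qg_seq_\<alpha>: "qg_seq (\<alpha> q)" and val_\<alpha>: "val (\<alpha> q) = 1"
  using qg_seq_quasi_greedy[of 1] M_ge_1 by (auto simp: \<alpha>_def)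

lemma \<alpha>_digits [simp]: "\<alpha> q \<in> digits"
  using qg_seq_\<alpha> by (simp add: qg_seq_def)

lemma \<alpha>_first: "\<alpha> q 0 = m"
proof (rule ccontr)
  assume "\<alpha> q 0 \<noteq> m"
  then have less: "\<alpha> q 0 < m" using digits_le[OF \<alpha>_digits, of 0] by simp
  then have "val (tail_seq 1 (\<alpha> q)) \<le> 1" using qg_seq_\<alpha> by (simp add: qg_seq_def)
  moreover have "real (\<alpha> q 0) + val (tail_seq 1 (\<alpha> q)) = q"
    using val_first[OF \<alpha>_digits] val_\<alpha> q_gt_1 by simp
  ultimately show False using less m_bounds(1) by linarith
qed

lemma reflect_eq_flip: "reflect q = flip"
  by (auto simp: reflect_def flip_def \<alpha>_first fun_eq_iff)

lemma lex_le_\<alpha>: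
  assumes "d \<in> digits" "infinite_seq d" "val d \<le> 1"
  shows "lex_le d (\<alpha> q)"
  using qg_seq_val_less[OF qg_seq_\<alpha> assms(1,2)] lex_le_total[of d "\<alpha> q"] assms(3) val_\<alpha> by auto

lemma lex_le_zero: "lex_le (\<lambda>_. 0) (d :: nat \<Rightarrow> nat)"
  using lex_le_total[of "\<lambda>_. 0" d] by (auto simp: less_fun_def)

text \<open>A bound \<open>1 + s\<close> for the values of all tails in question improves to \<open>1 + s / q\<close>, by
  comparison with \<open>\<alpha>\<close> up to the first difference.  Iteration from the trivial bound
  \<open>1 + M\<close> gives the bound \<open>1\<close>.\<close>
lemma tail_le_one_if_lex_le:
  assumes D: "d \<in> digits"
    and lex: "\<And>n. d n < m \<Longrightarrow> lex_le (tail_seq (Suc n) d) (\<alpha> q)"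
    and n: "d n < m"
  shows "val (tail_seq (Suc n) d) \<le> 1"
proof -
  have bound: "d n < m \<Longrightarrow> val (tail_seq (Suc n) d) \<le> 1 + M / q ^ k" for k n
  proof (induction k arbitrary: n)
    case 0
    then show ?case using val_le_M[OF tail_digits[OF D]] by (simp add: add_increasing)
  next
    case (Suc k)
    define t where "t = tail_seq (Suc n) d"
    have tD: "t \<in> digits" using D by (simp add: t_def)
    have nonneg: "0 \<le> M / q ^ Suc k" using M_ge_1 q_gt_1 by simp
    show ?case
    proof (cases "t = \<alpha> q")
      case True
      then show ?thesis using val_\<alpha> nonneg by (simp add: t_def)
    next
      case False
      then have "less_fun t (\<alpha> q)" using lex[OF Suc.prems] by (simp add: lex_le_def t_def)
      then obtain i where i: "t i < \<alpha> q i" "\<And>j. j < i \<Longrightarrow> t j = \<alpha> q j"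
        by (rule less_funE) auto
      have "d (Suc n + i) < m" using i(1) digits_le[OF \<alpha>_digits, of i] by (simp add: t_def tail_seq_apply)
      from Suc.IH[OF this] have "val (tail_seq (Suc i) t) \<le> 1 + M / q ^ k" by (simp add: t_def)
      moreover have "0 \<le> val (tail_seq (Suc i) (\<alpha> q))" by (simp add: val_nonneg)
      moreover have "real (t i) + 1 \<le> real (\<alpha> q i)" using i(1) by simp
      ultimately have "real (t i) - real (\<alpha> q i) + val (tail_seq (Suc i) t)
          - val (tail_seq (Suc i) (\<alpha> q)) \<le> M / q ^ k"
        by linarith
      then have "val t - val (\<alpha> q) \<le> M / q ^ k / q ^ Suc i"
        by (subst val_diff[of t "\<alpha> q" i, OF tD \<alpha>_digits i(2)])
          (use q_gt_1 in \<open>auto intro!: divide_right_mono simp del: divide_divide_eq_left\<close>)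
      also have "\<dots> \<le> M / q ^ k / q ^ 1"
        using q_gt_1 M_ge_1 by (intro divide_left_mono power_increasing) auto
      finally show ?thesis by (simp add: val_\<alpha> t_def field_simps)
    qed
  qed
  have "(\<lambda>k. M / q ^ k) \<longlonglongrightarrow> 0"
    using q_gt_1 LIMSEQ_divide_realpow_zero by blast
  then have "(\<lambda>k. 1 + M / q ^ k) \<longlonglongrightarrow> 1 + 0" by (intro tendsto_intros)
  then show ?thesis using bound[OF n] by (intro LIMSEQ_le_const[where X = "\<lambda>k. 1 + M / q ^ k"]) auto
qed

section \<open>Admissible sequences\<close>

text \<open>The digit sequences for which no digit can be increased or decreased with room to spare;
  \<open>M - val (tail_seq (Suc n) c)\<close> is the value of the reflected tail.\<close>
definition admissible :: "(nat \<Rightarrow> nat) set" where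
  "admissible = {c \<in> digits. \<forall>n. (c n < m \<longrightarrow> val (tail_seq (Suc n) c) \<le> 1)
     \<and> (0 < c n \<longrightarrow> M - 1 \<le> val (tail_seq (Suc n) c))}"

lemma admissible_digits: "c \<in> admissible \<Longrightarrow> c \<in> digits"
  by (simp add: admissible_def)

lemma admissible_less_m: "c \<in> admissible \<Longrightarrow> c n < m \<Longrightarrow> val (tail_seq (Suc n) c) \<le> 1"
  by (simp add: admissible_def)

lemma admissible_pos: "c \<in> admissible \<Longrightarrow> 0 < c n \<Longrightarrow> M - 1 \<le> val (tail_seq (Suc n) c)"
  unfolding admissible_def by blast

lemma admissible_tail: "c \<in> admissible \<Longrightarrow> tail_seq n c \<in> admissible"
  by (auto simp: admissible_def tail_seq_apply)

lemma admissible_flip: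
  assumes "c \<in> admissible"
  shows "flip c \<in> admissible"
proof -
  have val: "val (tail_seq n (flip c)) = M - val (tail_seq n c)" for n
    using assms by (simp add: tail_flip val_flip admissible_digits)
  have "M - val (tail_seq (Suc n) c) \<le> 1" if "flip c n < m" for n
    using admissible_pos[OF assms flip_less_m[OF that]] by simp
  moreover have "M - 1 \<le> M - val (tail_seq (Suc n) c)" if "0 < flip c n" for n
    using admissible_less_m[OF assms flip_pos[OF that]] by simp
  ultimately show ?thesis by (simp add: admissible_def val)
qed

text \<open>At the first difference from another expansion the digits differ by at least \<open>1\<close>, and the
  tails, which lie between \<open>0\<close> and \<open>M\<close>, cannot compensate for it.\<close>
lemma unique_if_strict:
  assumes cD: "c \<in> digits"
    and lo: "\<And>n. c n < m \<Longrightarrow> val (tail_seq (Suc n) c) < 1"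
    and hi: "\<And>n. 0 < c n \<Longrightarrow> M - 1 < val (tail_seq (Suc n) c)"
  shows "val c \<in> U_set q"
  unfolding U_set_def mem_Collect_eq
proof (rule ex1I[of _ c])
  show "is_expansion q (val c) c" using cD by (simp add: is_expansion_iff)
next
  fix d assume "is_expansion q (val c) d"
  then have d: "d \<in> digits" "val d = val c" by (auto simp: is_expansion_iff)
  show "d = c"
  proof (rule ccontr)
    assume "d \<noteq> c"
    then obtain i where i: "d i \<noteq> c i" "\<And>j. j < i \<Longrightarrow> d j = c j" by (rule first_difference) auto
    have "0 = (real (d i) - real (c i)
        + val (tail_seq (Suc i) d) - val (tail_seq (Suc i) c)) / q ^ Suc i"
      using val_diff[of d c i, OF d(1) cD i(2)] d(2) by simp
    then have eq: "real (d i) + val (tail_seq (Suc i) d) = real (c i) + val (tail_seq (Suc i) c)"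
      using q_gt_1 by simp
    have b: "0 \<le> val (tail_seq (Suc i) d)" "val (tail_seq (Suc i) d) \<le> M"
      using d(1) by (simp_all add: val_nonneg val_le_M)
    consider "c i < d i" | "d i < c i" using i(1) by linarith
    then show False
    proof cases
      case 1
      then have "c i < m" using digits_le[OF d(1), of i] by simp
      then show False using lo[of i] eq b 1 by linarith
    next
      case 2
      then show False using hi[of i] eq b by linarith
    qed
  qed
qed

text \<open>A digit of \<open>c\<close> can be replaced as soon as the remainder left by the new digit has an expansion.\<close>
lemma not_unique_if_replaceable:
  assumes cD: "c \<in> digits" and e: "e \<le> m" "e \<noteq> c n"
    and y: "0 \<le> val (tail_seq (Suc n) c) + real (c n) - real e"
      "val (tail_seq (Suc n) c) + real (c n) - real e \<le> M"
  shows "val c \<notin> U_set q"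
proof -
  obtain s where s: "s \<in> digits" "val s = val (tail_seq (Suc n) c) + real (c n) - real e"
    by (rule expansion_ex[OF y]) auto
  define d where "d = (\<lambda>i. if i < n then c i else if i = n then e else s (i - Suc n))"
  have dD: "d \<in> digits" using cD s e by (auto simp: digits_def d_def)
  have "tail_seq (Suc n) d = s" by (auto simp: tail_seq_def d_def)
  then have "val d - val c = 0"
    using val_diff[of d c n, OF dD cD] s(2) by (simp add: d_def)
  moreover have "d \<noteq> c" using e(2) by (auto simp: d_def fun_eq_iff)
  ultimately show ?thesis using cD dD by (auto simp: U_set_def is_expansion_iff)
qed

lemma unique_subset_admissible: "U_set q \<subseteq> val ` admissible"
proof
  fix x assume x: "x \<in> U_set q"
  then obtain c where c: "c \<in> digits" "val c = x" by (auto simp: U_set_def is_expansion_iff)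
  have "val (tail_seq (Suc n) c) \<le> 1" if "c n < m" for n
  proof (rule ccontr)
    assume "\<not> ?thesis"
    then have "val c \<notin> U_set q"
      using that c(1) val_le_M[OF tail_digits[OF c(1)], of "Suc n"]
      by (intro not_unique_if_replaceable[of c "Suc (c n)" n]) auto
    then show False using x c(2) by simp
  qed
  moreover have "M - 1 \<le> val (tail_seq (Suc n) c)" if "0 < c n" for n
  proof (rule ccontr)
    assume "\<not> ?thesis"
    then have "val c \<notin> U_set q"
      using that c(1) val_nonneg[OF tail_digits[OF c(1)], of "Suc n"] digits_le[OF c(1), of n]
      by (intro not_unique_if_replaceable[of c "c n - 1" n]) (auto simp: of_nat_diff)
    then show False using x c(2) by simp
  qed
  ultimately have "c \<in> admissible" using c(1) by (simp add: admissible_def)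
  then show "x \<in> val ` admissible" using c(2) by auto
qed

text \<open>In the quasi-greedy expansion of \<open>x\<close> the tails after digits below \<open>m\<close> are at most \<open>1\<close>
  anyway; the condition in \<open>V_set\<close> bounds the reflected tails.\<close>
lemma V_set_subset_admissible: "V_set q \<subseteq> val ` admissible"
proof
  fix x assume x: "x \<in> V_set q"
  then have xJ: "0 \<le> x" "x \<le> M" by (auto simp: V_set_def J_eq)
  show "x \<in> val ` admissible"
  proof (cases "x = 0")
    case True
    have "(\<lambda>_. 0) \<in> admissible" by (simp add: admissible_def digits_def tail_seq_def)
    then show ?thesis using True by (intro image_eqI[of _ _ "\<lambda>_. 0"]) auto
  next
    case False
    define a where "a = quasi_greedy q x"
    have a: "qg_seq a" "val a = x"
      using qg_seq_quasi_greedy[of x] False xJ by (auto simp: a_def)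
    then have aD: "a \<in> digits" by (simp add: qg_seq_def)
    have "lex_le (flip (tail_seq (Suc n) a)) (\<alpha> q)" if "0 < a n" for n
    proof -
      have "lex_le (flip (tail_seq k a)) (\<alpha> q)" if "k \<ge> 1" "0 < a (k - 1)" for k
        using x that by (auto simp: V_set_def reflect_eq_flip a_def)
      from this[of "Suc n"] that show ?thesis by simp
    qed
    then have flip_le: "val (tail_seq (Suc n) (flip a)) \<le> 1" if "flip a n < m" for n
      using that by (intro tail_le_one_if_lex_le) (auto simp: tail_flip dest: flip_less_m)
    have "M - 1 \<le> val (tail_seq (Suc n) a)" if "0 < a n" for n
    proof -
      have "flip a n < m" using that m_bounds(3) by (simp add: flip_def)
      then show ?thesis using flip_le[of n] aD by (simp add: tail_flip val_flip)
    qed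
    then have "a \<in> admissible" using a(1) by (simp add: admissible_def qg_seq_def)
    then show ?thesis using a(2) by auto
  qed
qed

section \<open>Compactness\<close>

lemma compact_digits: "compact digits"
proof -
  have "compactin (product_topology (\<lambda>_. euclidean) UNIV) (PiE UNIV (\<lambda>_::nat. {..m}))"
    by (simp add: compactin_PiE finite_imp_compact)
  moreover have "PiE UNIV (\<lambda>_::nat. {..m}) = digits" by (auto simp: digits_def)
  ultimately show ?thesis by (simp add: euclidean_product_topology)
qed

lemma continuous_on_val_tail: "continuous_on digits (\<lambda>c. val (tail_seq n c))"
proof -
  have "uniform_limit digits (\<lambda>k c. \<Sum>i<k. real (tail_seq n c i) / q ^ (i + 1))
      (\<lambda>c. val (tail_seq n c)) sequentially"
    unfolding val_def
    by (rule Weierstrass_m_test[OF _ sums_summable[OF constant_m_sums]])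
      (rule term_bound[OF tail_digits])
  moreover have "continuous_on digits (\<lambda>c. \<Sum>i<k. real (tail_seq n c i) / q ^ (i + 1))" for k
  proof -
    have "continuous_on digits (\<lambda>c. real (c i))" for i
      by (rule continuous_on_compose2[of UNIV real _ "\<lambda>c. c i"])
        (auto intro: continuous_on_subset[OF continuous_on_product_coordinates])
    then show ?thesis using q_gt_1 by (auto simp: tail_seq_apply intro!: continuous_on_sum continuous_on_divide)
  qed
  ultimately show ?thesis by (intro uniform_limit_theorem) auto
qed

lemma compact_admissible: "compact admissible"
proof -
  have "digits = (\<Inter>i. {c. c i \<le> m})" by (auto simp: digits_def)
  then have D: "closed digits"
    by (auto intro!: closed_INT closed_Collect_le)
  define A where "A n = ({c. m \<le> c n} \<union> digits \<inter> (\<lambda>c. val (tail_seq (Suc n) c)) -` {..1})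
      \<inter> ({c. c n \<le> 0} \<union> digits \<inter> (\<lambda>c. val (tail_seq (Suc n) c)) -` {M - 1..})" for n
  have "closed (A n)" for n
    unfolding A_def
    by (intro closed_Int closed_Un closed_Collect_le continuous_on_product_coordinates
        continuous_on_const continuous_closed_preimage[OF continuous_on_val_tail D]
        closed_atMost closed_atLeast)
  then have "compact (digits \<inter> (\<Inter>n. A n))"
    by (intro compact_Int_closed compact_digits closed_INT) auto
  also have "digits \<inter> (\<Inter>n. A n) = admissible"
    unfolding A_def admissible_def by (auto simp: not_less) (metis not_less not_gr_zero)+
  finally show ?thesis .
qed

lemma closed_val_admissible: "closed (val ` admissible)"
proof (rule compact_imp_closed, rule compact_continuous_image[OF _ compact_admissible])
  show "continuous_on admissible val"
    using continuous_on_subset[OF continuous_on_val_tail[of 0], of admissible] admissible_digits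
    by auto
qed

section \<open>Bases outside \<open>V_bases\<close>\<close>

text \<open>If \<open>M = 1\<close>, then \<open>\<alpha>\<close> is the constant sequence \<open>m\<close>, and its reflected tails vanish.\<close>
lemma M_gt_1:
  assumes "q \<notin> V_bases"
  shows "1 < M"
proof (rule ccontr)
  assume "\<not> 1 < M"
  then have "val (\<lambda>_. m) = 1" using M_ge_1 by simp
  moreover have "qg_seq (\<lambda>_. m)"
    using m_bounds(3) by (simp add: qg_seq_def digits_def infinite_seq_def)
  ultimately have "\<alpha> q = (\<lambda>_. m)" using quasi_greedy_eq[of "\<lambda>_. m"] by (simp add: \<alpha>_def)
  then have "flip (tail_seq k (\<alpha> q)) = (\<lambda>_. 0)" for k by (simp add: flip_def tail_seq_def)
  then have "q \<in> V_bases"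
    using q_gt_1 by (simp add: V_bases_def reflect_eq_flip lex_le_zero)
  with assms show False ..
qed

text \<open>After its last nonzero digit a finite nonzero sequence has a reflected tail of value \<open>M\<close>, which
  exceeds \<open>1\<close>.\<close>
lemma admissible_zero_or_infinite:
  assumes "1 < M" "c \<in> admissible"
  shows "c = (\<lambda>_. 0) \<or> infinite_seq c"
proof (rule ccontr)
  assume neg: "\<not> ?thesis"
  then have fin: "finite {i. c i \<noteq> 0}" and ne: "{i. c i \<noteq> 0} \<noteq> {}"
    by (auto simp: infinite_seq_def)
  define p where "p = Max {i. c i \<noteq> 0}"
  have "0 < c p" using Max_in[OF fin ne] by (simp add: p_def)
  moreover have "c (Suc p + i) = 0" for i
    using Max_ge[OF fin, of "Suc p + i"] by (fastforce simp: p_def)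
  then have "tail_seq (Suc p) c = (\<lambda>_. 0)" by (simp add: tail_seq_def)
  then have "val (tail_seq (Suc p) c) = 0" by simp
  ultimately have "M - 1 \<le> 0" using admissible_pos[OF assms(2), of p] by simp
  then show False using assms(1) by simp
qed

lemma admissible_lex_le_\<alpha>:
  assumes "1 < M" "c \<in> admissible" "val c \<le> 1"
  shows "lex_le c (\<alpha> q)"
  using admissible_zero_or_infinite[OF assms(1,2)] lex_le_zero lex_le_\<alpha>[OF _ _ assms(3)]
    admissible_digits[OF assms(2)] by auto

lemma admissible_qg_seq:
  assumes "c \<in> admissible" "infinite_seq c"
  shows "qg_seq c"
  using assms by (simp add: qg_seq_def admissible_def)

text \<open>If \<open>\<alpha>\<close> is admissible, then its reflected tails are admissible with values at most \<open>1\<close>,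
  by definition after a positive digit and inductively after a digit \<open>0\<close>.\<close>
lemma \<alpha>_not_admissible:
  assumes "q \<notin> V_bases"
  shows "\<alpha> q \<notin> admissible"
proof
  assume adm: "\<alpha> q \<in> admissible"
  have le: "val (flip (tail_seq (Suc n) (\<alpha> q))) \<le> 1" for n
  proof (induction n)
    case 0
    have "M - 1 \<le> val (tail_seq (Suc 0) (\<alpha> q))"
      using admissible_pos[OF adm, of 0] m_bounds(3) \<alpha>_first by simp
    then show ?case by (simp add: val_flip)
  next
    case (Suc n)
    show ?case
    proof (cases "\<alpha> q (Suc n) = 0")
      case False
      then have "M - 1 \<le> val (tail_seq (Suc (Suc n)) (\<alpha> q))" by (intro admissible_pos adm) simp
      then show ?thesis by (simp add: val_flip)
    next
      case True
      \<comment> \<open>The reflected tail starts with \<open>m\<close>, and \<open>q - m \<le> 1\<close>.\<close>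
      have "val (flip (tail_seq (Suc n) (\<alpha> q)))
          = (real m + val (flip (tail_seq (Suc (Suc n)) (\<alpha> q)))) / q"
        using val_first[OF flip_digits, of "tail_seq (Suc n) (\<alpha> q)"] True
        by (simp add: tail_flip) (simp add: flip_def tail_seq_apply)
      then have "real m + val (flip (tail_seq (Suc (Suc n)) (\<alpha> q))) \<le> q"
        using Suc.IH q_gt_1 by simp
      then show ?thesis using m_bounds(2) by linarith
    qed
  qed
  have "lex_le (reflect q (tail_seq k (\<alpha> q))) (\<alpha> q)" if "1 \<le> k" for k
  proof -
    have "flip (tail_seq k (\<alpha> q)) \<in> admissible" by (intro admissible_flip admissible_tail adm)
    moreover have "val (flip (tail_seq k (\<alpha> q))) \<le> 1" using le[of "k - 1"] that by simp
    ultimately show ?thesis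
      using admissible_lex_le_\<alpha>[OF M_gt_1[OF assms]] by (simp add: reflect_eq_flip)
  qed
  then show False using assms q_gt_1 by (auto simp: V_bases_def)
qed

lemma admissible_val_neq_one:
  assumes "q \<notin> V_bases" "c \<in> admissible"
  shows "val c \<noteq> 1"
proof
  assume 1: "val c = 1"
  then have "c \<noteq> (\<lambda>_. 0)" by auto
  then have "qg_seq c"
    using admissible_zero_or_infinite[OF M_gt_1] admissible_qg_seq assms by blast
  then have "c = \<alpha> q" using quasi_greedy_eq[of c] 1 by (simp add: \<alpha>_def)
  then show False using \<alpha>_not_admissible assms by simp
qed

lemma admissible_tail_less_one:
  assumes "q \<notin> V_bases" "c \<in> admissible" "c n < m"
  shows "val (tail_seq (Suc n) c) < 1"
proof -
  have "val (tail_seq (Suc n) c) \<le> 1" by (rule admissible_less_m[OF assms(2,3)])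
  moreover have "val (tail_seq (Suc n) c) \<noteq> 1"
    by (intro admissible_val_neq_one admissible_tail assms)
  ultimately show ?thesis by simp
qed

lemma val_admissible_unique:
  assumes "q \<notin> V_bases" "c \<in> admissible"
  shows "val c \<in> U_set q"
proof (rule unique_if_strict)
  show cD: "c \<in> digits" by (rule admissible_digits[OF assms(2)])
  show "val (tail_seq (Suc n) c) < 1" if "c n < m" for n
    by (rule admissible_tail_less_one[OF assms that])
  show "M - 1 < val (tail_seq (Suc n) c)" if "0 < c n" for n
  proof -
    have "flip c n < m" using that m_bounds(3) by (simp add: flip_def)
    then have "val (tail_seq (Suc n) (flip c)) < 1"
      by (intro admissible_tail_less_one admissible_flip assms)
    then show ?thesis using cD by (simp add: tail_flip val_flip)
  qed
qed

lemma val_admissible_in_V_set: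
  assumes "q \<notin> V_bases" "c \<in> admissible"
  shows "val c \<in> V_set q"
proof -
  have cD: "c \<in> digits" by (rule admissible_digits[OF assms(2)])
  then have J: "val c \<in> J q" by (simp add: J_eq val_nonneg val_le_M)
  show ?thesis
  proof (cases "c = (\<lambda>_. 0)")
    case True
    then show ?thesis using J by (simp add: V_set_def quasi_greedy_def)
  next
    case False
    then have "infinite_seq c"
      using admissible_zero_or_infinite[OF M_gt_1] assms by blast
    then have qg: "quasi_greedy q (val c) = c"
      by (intro quasi_greedy_eq admissible_qg_seq assms)
    have "lex_le (flip (tail_seq n c)) (\<alpha> q)" if "n \<ge> 1" "0 < c (n - 1)" for n
    proof (rule admissible_lex_le_\<alpha>[OF M_gt_1[OF assms(1)]])
      show "flip (tail_seq n c) \<in> admissible" by (intro admissible_flip admissible_tail assms)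
      have "M - 1 \<le> val (tail_seq (Suc (n - 1)) c)"
        by (rule admissible_pos[OF assms(2) that(2)])
      then show "val (flip (tail_seq n c)) \<le> 1" using that(1) cD by (simp add: val_flip)
    qed
    then show ?thesis using J by (simp add: V_set_def qg reflect_eq_flip)
  qed
qed

end

theorem theorem1p5:
  fixes q :: real
  assumes "q \<in> {1<..} - V_bases"
  shows "U_set q = closure (U_set q) \<and> closure (U_set q) = V_set q"
proof -
  interpret base q by unfold_locales (use assms in auto)
  have U: "U_set q = val ` admissible"
    using unique_subset_admissible val_admissible_unique assms by auto
  moreover have "V_set q = val ` admissible"
    using V_set_subset_admissible val_admissible_in_V_set assms by auto
  moreover have "closure (U_set q) = U_set q"
    unfolding U by (rule closure_closed[OF closed_val_admissible])
  ultimately show ?thesis by simp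
qed

end
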